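(* Assume the setting described in the context, with $M>0$, $X=[-M,M]^n$ and $Y$ compact. Suppose $$g(x,y)=\frac1n\sum_{i=1}^n\omega(x_i)\,\ell_i(y),\qquad \omega\ge0,\quad\omega'>0\ \text{on }[-M,M],$$ where each $\ell_i$ is continuous on $Y$. Define $$D_\ell:=\max_{1\le i\le n}\Bigl(\max_{y\in Y}\ell_i(y)-\min_{y\in Y}\ell_i(y)\Bigr).$$ If $\delta>\omega(-M)D_\ell$, then ENNAMCQ holds on $X\times Y$, i.e. $0\notin\nabla R(w)+N_C(w)$ for every $w\in C$ with $R(w)\ge0$.
   Context: Setting. $X\subset\mathbb R^n$ and $Y\subset\mathbb R^m$ are nonempty, compact, convex; $C=X\times Y$. The function $g$ is real-valued, continuously differentiable on a neighborhood of $C$, with $\nabla g$ Lipschitz on $C$. $\sigma\ge0$ is such that $g(x,\cdot)+\frac\sigma2\|\cdot\|^2$ is convex on $Y$ for every $x\in X$; $\rho>0$ satisfies $\rho\sigma<1$, and $\delta>0$. Put $g_\rho(x,y)=\min_{z\in Y}\{g(x,z)+\frac1{2\rho}\|z-y\|^2\}$, with unique minimizer $z_\rho(x,y)$, and $R(x,y)=g(x,y)-g_\rho(x,y)-\delta$. $R$ is continuously differentiable on $C$ with $\nabla R(x,y)=\bigl(\nabla_xg(x,y)-\nabla_xg(x,z_\rho(x,y)),\ \nabla_yg(x,y)-\rho^{-1}(y-z_\rho(x,y))\bigr)$. $N_C$ denotes the normal cone to $C$ in the sense of convex analysis. *)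

theory Defs
  imports "HOL-Analysis.Analysis"
begin

(* A genuine gradient only where f is differentiable; otherwise the value is unspecified. *)
definition grad :: "('a::real_inner \<Rightarrow> real) \<Rightarrow> 'a \<Rightarrow> 'a" where
  "grad f w = (THE D. GDERIV f w :> D)"

lemma GDERIV_unique:
  assumes "GDERIV f w :> D" and "GDERIV f w :> E"
  shows "D = E"
proof -
  have "(\<lambda>h. h \<bullet> D) = (\<lambda>h. h \<bullet> E)"
    using assms unfolding gderiv_def by (rule has_derivative_unique)
  then have "\<And>h. h \<bullet> D = h \<bullet> E"
    by (rule fun_cong)
  then have "(D - E) \<bullet> (D - E) = 0"
    by (simp add: inner_diff_right)
  then show ?thesis
    by simp
qed

lemma grad_eqI: "GDERIV f w :> D \<Longrightarrow> grad f w = D"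
  unfolding grad_def by (blast intro: the_equality GDERIV_unique)

definition normal_cone :: "'a::real_inner set \<Rightarrow> 'a \<Rightarrow> 'a set" where
  "normal_cone C w = {v. w \<in> C \<and> (\<forall>u\<in>C. v \<bullet> (u - w) \<le> 0)}"

(* The infimum is a minimum whenever Y is nonempty and compact and g (x, _) is continuous on Y. *)
definition partial_moreau_env ::
  "('a \<times> 'b::real_normed_vector \<Rightarrow> real) \<Rightarrow> real \<Rightarrow> 'b set \<Rightarrow> 'a \<times> 'b \<Rightarrow> real" where
  "partial_moreau_env g \<rho> Y =
     (\<lambda>(x, y). INF z\<in>Y. g (x, z) + 1 / (2 * \<rho>) * (norm (z - y))\<^sup>2)"

definition value_constraint ::
  "('a \<times> 'b::real_normed_vector \<Rightarrow> real) \<Rightarrow> real \<Rightarrow> real \<Rightarrow> 'b set \<Rightarrow> 'a \<times> 'b \<Rightarrow> real" where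
  "value_constraint g \<rho> \<delta> Y w = g w - partial_moreau_env g \<rho> Y w - \<delta>"

(* Extended no nonzero abnormal multiplier constraint qualification for the constraint R \<le> 0 on C. *)
definition ENNAMCQ :: "('a::real_inner \<Rightarrow> real) \<Rightarrow> 'a set \<Rightarrow> bool" where
  "ENNAMCQ R C \<longleftrightarrow> (\<forall>w\<in>C. R w \<ge> 0 \<longrightarrow> 0 \<notin> {grad R w + v |v. v \<in> normal_cone C w})"

(* Sup and Inf are attained when Y is nonempty and compact and every l i is continuous on Y. *)
definition max_oscillation :: "('i::finite \<Rightarrow> 'b \<Rightarrow> real) \<Rightarrow> 'b set \<Rightarrow> real" where
  "max_oscillation l Y = (MAX i. (SUP y\<in>Y. l i y) - (INF y\<in>Y. l i y))"

end

theory Submission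
  imports Defs
begin

text \<open>By Danskin's theorem R is differentiable on C, with x-gradient
  \<open>(1 / n) \<omega>'(x\<^sub>i) (l\<^sub>i(y) - l\<^sub>i(z))\<close> in component i, where z is the proximal point of (x, y).
  If minus the gradient is normal to C, then \<open>l\<^sub>i(y) \<le> l\<^sub>i(z)\<close> whenever \<open>x\<^sub>i > -M\<close>. So each
  summand of \<open>g(x, y) - g(x, z)\<close> is either nonpositive or carries the weight \<open>\<omega>(-M)\<close>, and
  the difference stays below \<open>\<delta>\<close>, which forces \<open>R(x, y) < 0\<close>.\<close>

section \<open>Attained infima over a compact set and their derivatives\<close>

lemma INF_compact_attained:
  fixes f :: "'b::topological_space \<Rightarrow> real"
  assumes "compact K" and "K \<noteq> {}" and "continuous_on K f"
  obtains z where "z \<in> K" and "\<And>u. u \<in> K \<Longrightarrow> f z \<le> f u" and "(INF u\<in>K. f u) = f z"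
proof -
  obtain z where z: "z \<in> K" "\<forall>u\<in>K. f z \<le> f u"
    using continuous_attains_inf[OF assms] by blast
  have "(INF u\<in>K. f u) = f z"
    by (rule cInf_eq_minimum) (use z in auto)
  with z that show thesis by blast
qed

(* Danskin's theorem. Minimizers at nearby parameters converge to z0, so the mean value
   inequality bounds the increment of the infimum from both sides. *)
lemma GDERIV_INF_unique_minimizer:
  fixes \<phi> :: "'a::real_inner \<times> 'b::metric_space \<Rightarrow> real"
  assumes N: "open N" "w0 \<in> N" and K: "compact K"
    and cont: "continuous_on (N \<times> K) \<phi>"
    and der: "\<And>w z. w \<in> N \<Longrightarrow> z \<in> K \<Longrightarrow> GDERIV (\<lambda>w. \<phi> (w, z)) w :> D (w, z)"
    and contD: "continuous_on (N \<times> K) D"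
    and z0: "z0 \<in> K" and min: "\<And>z. z \<in> K \<Longrightarrow> z \<noteq> z0 \<Longrightarrow> \<phi> (w0, z0) < \<phi> (w0, z)"
  shows "GDERIV (\<lambda>w. INF z\<in>K. \<phi> (w, z)) w0 :> D (w0, z0)"
proof -
  define f where "f = (\<lambda>w. INF z\<in>K. \<phi> (w, z))"
  have contK: "continuous_on K (\<lambda>z. \<phi> (w, z))" if "w \<in> N" for w
    by (rule continuous_on_compose2[OF cont]) (use that in \<open>auto intro!: continuous_intros\<close>)
  have att: "\<exists>z\<in>K. f w = \<phi> (w, z) \<and> (\<forall>u\<in>K. \<phi> (w, z) \<le> \<phi> (w, u))" if "w \<in> N" for w
    using INF_compact_attained[OF K _ contK[OF that]] z0 unfolding f_def by (metis empty_iff)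
  have f0: "f w0 = \<phi> (w0, z0)"
    using att[OF N(2)] min z0 by (metis leD)
  have "\<exists>d>0. \<forall>w. norm (w - w0) < d \<longrightarrow>
      norm (f w - f w0 - (w - w0) \<bullet> D (w0, z0)) \<le> e * norm (w - w0)" if e: "e > 0" for e
  proof -
    obtain d1 where d1: "d1 > 0"
      "\<And>p. p \<in> N \<times> K \<Longrightarrow> dist p (w0, z0) < d1 \<Longrightarrow> dist (D p) (D (w0, z0)) < e"
      using contD e N(2) z0 unfolding continuous_on_iff by (metis SigmaI)
    obtain d2 where d2: "d2 > 0" "ball w0 d2 \<subseteq> N"
      using N open_contains_ball by blast
    \<comment> \<open>Away from \<open>z0\<close>, strict minimality improves to a uniform margin,
      because a minimum is attained on the compact set that remains after a ball is removed. If
      nothing remains, any positive margin serves.\<close>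
    have "\<exists>\<eta>>0. \<forall>z\<in>K - ball z0 (d1/2). \<phi> (w0, z0) + \<eta> \<le> \<phi> (w0, z)"
    proof (cases "K - ball z0 (d1/2) = {}")
      case False
      have "compact (K - ball z0 (d1/2))"
        using K by (simp add: compact_diff)
      moreover have "continuous_on (K - ball z0 (d1/2)) (\<lambda>z. \<phi> (w0, z))"
        using contK[OF N(2)] by (rule continuous_on_subset) auto
      ultimately obtain z1 where z1: "z1 \<in> K - ball z0 (d1/2)"
        "\<And>z. z \<in> K - ball z0 (d1/2) \<Longrightarrow> \<phi> (w0, z1) \<le> \<phi> (w0, z)"
        using INF_compact_attained[OF _ False] by metis
      have "z1 \<noteq> z0" using z1(1) d1(1) by auto
      then have "\<phi> (w0, z0) < \<phi> (w0, z1)" using min z1(1) by auto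
      then show ?thesis
        using z1(2) by (intro exI[of _ "\<phi> (w0, z1) - \<phi> (w0, z0)"]) auto
    qed (auto intro: exI[of _ 1])
    then obtain \<eta> where \<eta>: "\<eta> > 0"
      "\<And>z. z \<in> K \<Longrightarrow> z \<notin> ball z0 (d1/2) \<Longrightarrow> \<phi> (w0, z0) + \<eta> \<le> \<phi> (w0, z)"
      by blast
    \<comment> \<open>Compactness of \<open>K\<close> makes the change from \<open>w0\<close> to
      \<open>w\<close> small uniformly in \<open>z\<close>. Two such changes enter below, and their
      sum \<open>2 * \<eta> / 3\<close> stays under the margin.\<close>
    obtain V where V: "w0 \<in> V" "open V"
      "\<forall>w\<in>V \<inter> N. \<forall>z\<in>K. dist (\<phi> (w, z)) (\<phi> (w0, z)) \<le> \<eta> / 3"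
      using continuous_on_prod_compactE[OF cont K N(2), of "\<eta> / 3"] \<eta>(1) by auto
    obtain d3 where d3: "d3 > 0" "ball w0 d3 \<subseteq> V"
      using V open_contains_ball by blast
    \<comment> \<open>Half of \<open>d1\<close> is left for the distance from \<open>z\<close> to
      \<open>z0\<close>, so that \<open>(v, z)\<close> stays where \<open>D\<close> is within
      \<open>e\<close> of \<open>D (w0, z0)\<close>.\<close>
    define d where "d = min (d1/2) (min d2 d3)"
    have d: "d > 0" "ball w0 d \<subseteq> N" "ball w0 d \<subseteq> V" "d \<le> d1/2"
      using d1 d2 d3 unfolding d_def by auto
    have mvt: "\<bar>\<phi> (w, z) - \<phi> (w0, z) - (w - w0) \<bullet> D (w0, z0)\<bar> \<le> e * norm (w - w0)"
      if w: "w \<in> ball w0 d" and z: "z \<in> K" "z \<in> ball z0 (d1/2)" for w z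
    proof -
      \<comment> \<open>Subtracting the linear function with gradient \<open>D (w0, z0)\<close>
        leaves a function whose derivative has norm at most \<open>e\<close> on the ball.\<close>
      have "norm ((\<phi> (w, z) - w \<bullet> D (w0, z0)) - (\<phi> (w0, z) - w0 \<bullet> D (w0, z0))) \<le> e * norm (w - w0)"
      proof (rule differentiable_bound[OF convex_ball])
        fix v assume v: "v \<in> ball w0 d"
        have "((\<lambda>v. \<phi> (v, z)) has_derivative (\<lambda>h. h \<bullet> D (v, z))) (at v within ball w0 d)"
          using der[of v z] v d(2) z unfolding gderiv_def by (blast intro: has_derivative_at_withinI)
        then have "((\<lambda>v. \<phi> (v, z) - v \<bullet> D (w0, z0)) has_derivative
            (\<lambda>h. h \<bullet> D (v, z) - h \<bullet> D (w0, z0))) (at v within ball w0 d)"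
          by (auto intro!: derivative_eq_intros)
        then show "((\<lambda>v. \<phi> (v, z) - v \<bullet> D (w0, z0)) has_derivative
            (\<lambda>h. h \<bullet> (D (v, z) - D (w0, z0)))) (at v within ball w0 d)"
          by (simp add: inner_diff_right)
        have "dist (v, z) (w0, z0) \<le> dist v w0 + dist z z0"
          unfolding dist_prod_def by (simp add: sqrt_sum_squares_le_sum)
        also have "\<dots> < d1" using v z d(4) by (auto simp: dist_commute)
        finally have "dist (D (v, z)) (D (w0, z0)) < e"
          using d1(2)[of "(v, z)"] v d(2) z by auto
        then have nb: "norm (D (v, z) - D (w0, z0)) \<le> e" by (simp add: dist_norm)
        show "onorm (\<lambda>h. h \<bullet> (D (v, z) - D (w0, z0))) \<le> e"
        proof (rule onorm_bound)
          fix h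
          have "norm (h \<bullet> (D (v, z) - D (w0, z0))) \<le> norm h * norm (D (v, z) - D (w0, z0))"
            by (simp add: Cauchy_Schwarz_ineq2)
          also have "\<dots> \<le> norm h * e" using nb by (simp add: mult_left_mono)
          finally show "norm (h \<bullet> (D (v, z) - D (w0, z0))) \<le> e * norm h" by (simp add: mult.commute)
        qed (use e in simp)
      qed (use w d(1) in auto)
      then show ?thesis by (simp add: inner_diff_left algebra_simps)
    qed
    have "\<bar>f w - f w0 - (w - w0) \<bullet> D (w0, z0)\<bar> \<le> e * norm (w - w0)" if w: "w \<in> ball w0 d" for w
    proof -
      have wN: "w \<in> N" and wV: "w \<in> V \<inter> N" using w d by auto
      obtain z where z: "z \<in> K" "f w = \<phi> (w, z)" "\<And>u. u \<in> K \<Longrightarrow> \<phi> (w, z) \<le> \<phi> (w, u)"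
        using att[OF wN] by auto
      have "\<bar>\<phi> (w, z) - \<phi> (w0, z)\<bar> \<le> \<eta> / 3" "\<bar>\<phi> (w, z0) - \<phi> (w0, z0)\<bar> \<le> \<eta> / 3"
        using V(3) wV z(1) z0 by (auto simp: dist_real_def)
      moreover have "\<phi> (w, z) \<le> \<phi> (w, z0)" using z z0 by simp
      ultimately have "\<phi> (w0, z) < \<phi> (w0, z0) + \<eta>" using \<eta>(1) by linarith
      \<comment> \<open>A minimizer at \<open>w\<close> is minimal at \<open>w0\<close> up to less
        than \<open>\<eta>\<close>, so it cannot lie outside the ball around
        \<open>z0\<close>.\<close>
      then have zb: "z \<in> ball z0 (d1/2)" using \<eta>(2)[OF z(1)] by fastforce
      \<comment> \<open>Sandwich: \<open>z\<close> as a competitor at \<open>w0\<close> bounds the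
        increment of \<open>f\<close> from below, and \<open>z0\<close> as a competitor at
        \<open>w\<close> bounds it from above.\<close>
      have "\<phi> (w0, z0) \<le> \<phi> (w0, z)" using min z(1) by force
      then show ?thesis
        using mvt[OF w z(1) zb] mvt[OF w z0] d1(1) \<open>\<phi> (w, z) \<le> \<phi> (w, z0)\<close>
        unfolding f0 z(2) by auto
    qed
    then show ?thesis using d(1)
      by (intro exI[of _ d]) (simp add: dist_norm norm_minus_commute)
  qed
  then show ?thesis
    unfolding gderiv_def has_derivative_at_alt f_def[symmetric]
    by (simp add: bounded_linear_inner_left)
qed

section \<open>Gradient and proximal point of the partial Moreau envelope\<close>

text \<open>Danskin's theorem with parameter \<open>(x, y)\<close>: with the minimizer frozen,
  \<open>g\<close> depends on the parameter only through \<open>x\<close> and the quadratic only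
  through \<open>y\<close>, so each supplies one component of the gradient.\<close>

lemma GDERIV_partial_moreau_env:
  fixes g :: "'a::real_inner \<times> 'b::real_inner \<Rightarrow> real"
  assumes Y: "compact Y" and W: "open W" "{x} \<times> Y \<subseteq> W" and \<rho>: "\<rho> \<noteq> 0"
    and der: "\<And>w. w \<in> W \<Longrightarrow> GDERIV g w :> G w" and contG: "continuous_on W G"
    and z: "z \<in> Y"
    and min: "\<And>u. u \<in> Y \<Longrightarrow> u \<noteq> z \<Longrightarrow>
      g (x, z) + 1 / (2 * \<rho>) * (norm (z - y))\<^sup>2 < g (x, u) + 1 / (2 * \<rho>) * (norm (u - y))\<^sup>2"
  shows "GDERIV (partial_moreau_env g \<rho> Y) (x, y) :> (fst (G (x, z)), (1 / \<rho>) *\<^sub>R (y - z))"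
proof -
  \<comment> \<open>Differentiability is needed for all of \<open>Y\<close> at every nearby
    parameter, hence a whole tube inside \<open>W\<close>.\<close>
  obtain U where U: "x \<in> U" "open U" "U \<times> Y \<subseteq> W"
    using Elementary_Topology.tube_lemma[OF Y W] by blast
  define \<phi> where "\<phi> = (\<lambda>p. g (fst (fst p), snd p) + 1 / (2 * \<rho>) * (norm (snd p - snd (fst p)))\<^sup>2)"
  define D where "D = (\<lambda>p. (fst (G (fst (fst p), snd p)), (1 / \<rho>) *\<^sub>R (snd (fst p) - snd p)))"
  have contg: "continuous_on W g"
    using der unfolding gderiv_def
    by (meson has_derivative_at_withinI has_derivative_continuous_on)
  have "GDERIV (\<lambda>w. INF u\<in>Y. \<phi> (w, u)) (x, y) :> D ((x, y), z)"
  proof (rule GDERIV_INF_unique_minimizer[where N = "U \<times> UNIV"])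
    show "open (U \<times> (UNIV :: 'b set))" using U by (simp add: open_Times)
    show "continuous_on ((U \<times> UNIV) \<times> Y) \<phi>" unfolding \<phi>_def
      by (intro continuous_intros continuous_on_compose2[OF contg]) (use U in auto)
    show "continuous_on ((U \<times> UNIV) \<times> Y) D" unfolding D_def
      by (intro continuous_intros continuous_on_compose2[OF contG]) (use U in auto)
    fix w :: "'a \<times> 'b" and u assume w: "w \<in> U \<times> UNIV" and u: "u \<in> Y"
    have "(g has_derivative (\<lambda>h. h \<bullet> G (fst w, u))) (at (fst w, u))"
      using der[of "(fst w, u)"] U w u unfolding gderiv_def by auto
    then have "((\<lambda>w. g (fst w, u)) has_derivative (\<lambda>h. (fst h, 0) \<bullet> G (fst w, u))) (at w)"
      by (rule has_derivative_compose[rotated]) (auto intro!: derivative_eq_intros)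
    then show "GDERIV (\<lambda>w. \<phi> (w, u)) w :> D (w, u)"
      unfolding gderiv_def \<phi>_def D_def power2_norm_eq_inner
      using \<rho> by (auto intro!: derivative_eq_intros simp: inner_prod_def inner_diff_left inner_diff_right
          inner_commute algebra_simps add_divide_distrib diff_divide_distrib)
  qed (use U Y z min in \<open>auto simp: \<phi>_def\<close>)
  moreover have "(\<lambda>w. INF u\<in>Y. \<phi> (w, u)) = partial_moreau_env g \<rho> Y"
    by (auto simp: \<phi>_def partial_moreau_env_def)
  ultimately show ?thesis by (simp add: D_def)
qed

text \<open>Since \<open>\<sigma> / 2 < 1 / (2 * \<rho>)\<close>, the proximal objective is strongly
  convex, and the midpoint of two distinct minimizers would do strictly better. This provides the
  strict inequality that the envelope gradient requires.\<close>

lemma prox_unique: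
  fixes f :: "'b::real_inner \<Rightarrow> real"
  assumes conv: "convex_on Y (\<lambda>y. f y + \<sigma> / 2 * (norm y)\<^sup>2)" and \<rho>: "\<rho> > 0" "\<rho> * \<sigma> < 1"
    and z: "z \<in> Y" and u: "u \<in> Y" "u \<noteq> z"
    and min: "\<And>v. v \<in> Y \<Longrightarrow>
      f z + 1 / (2 * \<rho>) * (norm (z - y))\<^sup>2 \<le> f v + 1 / (2 * \<rho>) * (norm (v - y))\<^sup>2"
  shows "f z + 1 / (2 * \<rho>) * (norm (z - y))\<^sup>2 < f u + 1 / (2 * \<rho>) * (norm (u - y))\<^sup>2"
proof -
  define c where "c = 1 / (2 * \<rho>)"
  have c: "\<sigma> / 2 < c" using \<rho> by (simp add: c_def field_simps)
  define m where "m = (1/2) *\<^sub>R z + (1/2) *\<^sub>R u"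
  have "m \<in> Y" using conv z u convexD[of Y z u "1/2" "1/2"]
    by (auto simp: convex_on_def m_def)
  have 1: "f m + \<sigma> / 2 * (norm m)\<^sup>2
      \<le> (1/2) * (f z + \<sigma> / 2 * (norm z)\<^sup>2) + (1/2) * (f u + \<sigma> / 2 * (norm u)\<^sup>2)"
    using convex_onD[OF conv, of "1/2" z u] z u by (simp add: m_def)
  \<comment> \<open>Parallelogram identity, used with \<open>a = y\<close> for the proximal term and
    with \<open>a = 0\<close> for the convexity correction.\<close>
  have par: "(norm (m - a))\<^sup>2 = ((norm (z - a))\<^sup>2 + (norm (u - a))\<^sup>2) / 2 - (norm (u - z))\<^sup>2 / 4" for a
    unfolding power2_norm_eq_inner m_def
    by (simp add: inner_diff_left inner_diff_right inner_add_left inner_add_right inner_commute field_simps)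
  \<comment> \<open>\<open>q / 4\<close> is the gain of the midpoint over the average of the two
    values.\<close>
  define q where "q = (c - \<sigma> / 2) * (norm (u - z))\<^sup>2"
  have "0 < q" using c u by (simp add: q_def)
  moreover have "f m + c * (norm (m - y))\<^sup>2 \<le>
      (f z + c * (norm (z - y))\<^sup>2) / 2 + (f u + c * (norm (u - y))\<^sup>2) / 2
      - q / 4"
  proof -
    have "c * (norm (m - y))\<^sup>2 = c * (((norm (z - y))\<^sup>2 + (norm (u - y))\<^sup>2) / 2 - (norm (u - z))\<^sup>2 / 4)"
      using par[of y] by simp
    moreover have "\<sigma> / 2 * (norm m)\<^sup>2 = \<sigma> / 2 * (((norm z)\<^sup>2 + (norm u)\<^sup>2) / 2 - (norm (u - z))\<^sup>2 / 4)"
      using par[of 0] by simp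
    ultimately show ?thesis using 1 by (simp add: q_def field_simps)
  qed
  moreover have "f z + c * (norm (z - y))\<^sup>2 \<le> f m + c * (norm (m - y))\<^sup>2"
    using min[OF \<open>m \<in> Y\<close>] by (simp add: c_def)
  ultimately show ?thesis unfolding c_def[symmetric] by argo
qed

section \<open>Oscillations and partial derivatives of the separable function\<close>

lemma oscillation_le_max:
  assumes Y: "compact Y" and l: "\<And>i. continuous_on Y (l i)" and y: "y \<in> Y" "z \<in> Y"
  shows "l i y - l i z \<le> max_oscillation l Y"
proof -
  have "compact (l i ` Y)" using Y l by (rule compact_continuous_image[rotated])
  then have "bdd_above (l i ` Y)" "bdd_below (l i ` Y)"
    by (simp_all add: compact_imp_bounded bounded_imp_bdd_above bounded_imp_bdd_below)
  then have "l i y \<le> (SUP y\<in>Y. l i y)" "(INF y\<in>Y. l i y) \<le> l i z"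
    using y by (auto intro: cSUP_upper cINF_lower)
  then have "l i y - l i z \<le> (SUP y\<in>Y. l i y) - (INF y\<in>Y. l i y)" by linarith
  also have "\<dots> \<le> max_oscillation l Y"
    unfolding max_oscillation_def by (rule Max_ge) auto
  finally show ?thesis .
qed

text \<open>The product formula is available only on the box, and \<open>x\<close> may lie on its
  boundary. So \<open>g\<close> is restricted to the segment through \<open>x\<close> along axis
  \<open>i\<close>, and two derivatives within \<open>{a..b}\<close> are compared; on a
  nondegenerate interval they agree even at an endpoint.\<close>

lemma separable_grad_component:
  fixes g :: "(real ^ 'n) \<times> 'b::real_inner \<Rightarrow> real"
  assumes ab: "a < b" and x: "\<And>i. x $ i \<in> {a..b}"
    and G: "GDERIV g (x, z) :> G"
    and \<omega>: "(\<omega> has_real_derivative d) (at (x $ i) within {a..b})"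
    and eq: "\<And>u. (\<And>i. u $ i \<in> {a..b}) \<Longrightarrow> g (u, z) = k * (\<Sum>j\<in>UNIV. \<omega> (u $ j) * l j z)"
  shows "fst G $ i = k * (d * l i z)"
proof -
  define p where "p = (\<lambda>t. x + (t - x $ i) *\<^sub>R axis i (1::real))"
  have p: "p t $ j = (if j = i then t else x $ j)" for t j
    by (simp add: p_def axis_def)
  have pi: "p (x $ i) = x" by (simp add: p_def)
  have "((\<lambda>t. (p t, z)) has_derivative (\<lambda>h. (h *\<^sub>R axis i 1, 0))) (at (x $ i) within {a..b})"
    unfolding p_def by (auto intro!: derivative_eq_intros)
  moreover have "(g has_derivative (\<lambda>h. h \<bullet> G)) (at (p (x $ i), z))"
    using G by (simp add: pi gderiv_def)
  ultimately have "((\<lambda>t. g (p t, z)) has_derivative (\<lambda>h. (h *\<^sub>R axis i 1, 0) \<bullet> G)) (at (x $ i) within {a..b})"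
    by (rule has_derivative_compose)
  moreover have "(\<lambda>h. (h *\<^sub>R axis i 1, 0) \<bullet> G) = (\<lambda>h. h *\<^sub>R (fst G $ i))"
    by (auto simp: inner_prod_def inner_commute[of "axis i 1"] inner_axis)
  ultimately have 1: "((\<lambda>t. g (p t, z)) has_vector_derivative fst G $ i) (at (x $ i) within cbox a b)"
    by (simp add: has_vector_derivative_def)
  \<comment> \<open>Along the segment only the summand with index \<open>i\<close> varies.\<close>
  have gp: "g (p t, z) = k * (\<omega> t * l i z + (\<Sum>j\<in>UNIV - {i}. \<omega> (x $ j) * l j z))" if "t \<in> {a..b}" for t
  proof -
    have "g (p t, z) = k * (\<Sum>j\<in>UNIV. \<omega> (p t $ j) * l j z)"
      by (rule eq) (use that x in \<open>auto simp: p\<close>)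
    also have "(\<Sum>j\<in>UNIV. \<omega> (p t $ j) * l j z) = \<omega> t * l i z + (\<Sum>j\<in>UNIV - {i}. \<omega> (x $ j) * l j z)"
      by (subst sum.remove[of _ i]) (auto simp: p intro!: sum.cong)
    finally show ?thesis .
  qed
  have "((\<lambda>t. k * (\<omega> t * l i z + (\<Sum>j\<in>UNIV - {i}. \<omega> (x $ j) * l j z)))
      has_real_derivative k * (d * l i z)) (at (x $ i) within {a..b})"
    by (auto intro!: derivative_eq_intros \<omega>)
  then have "((\<lambda>t. g (p t, z)) has_real_derivative k * (d * l i z)) (at (x $ i) within {a..b})"
    by (rule has_field_derivative_transform_within[OF _ zero_less_one x]) (simp add: gp)
  then have 2: "((\<lambda>t. g (p t, z)) has_vector_derivative k * (d * l i z)) (at (x $ i) within cbox a b)"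
    by (simp add: has_real_derivative_iff_has_vector_derivative)
  show ?thesis
    by (rule vector_derivative_unique_within_closed_interval[OF ab _ 1 2]) (use x in simp)
qed

section \<open>The constraint qualification on the box\<close>

theorem proposition17:
  fixes g :: "(real ^ 'n) \<times> (real ^ 'm) \<Rightarrow> real"
    and X :: "(real ^ 'n) set" and Y :: "(real ^ 'm) set"
    and W :: "((real ^ 'n) \<times> (real ^ 'm)) set"
    and \<omega> \<omega>' :: "real \<Rightarrow> real"
    and l :: "'n \<Rightarrow> real ^ 'm \<Rightarrow> real"
    and M L \<sigma> \<rho> \<delta> :: real
  assumes "M > 0" and "X = {x. \<forall>i. x $ i \<in> {-M..M}}"
    and "Y \<noteq> {}" and "compact Y" and "convex Y"
    and "open W" and "X \<times> Y \<subseteq> W"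
    and "\<And>w. w \<in> W \<Longrightarrow> GDERIV g w :> grad g w"
    and "continuous_on W (grad g)"
    and "L-lipschitz_on (X \<times> Y) (grad g)"
    and "\<sigma> \<ge> 0"
    and "\<And>x. x \<in> X \<Longrightarrow> convex_on Y (\<lambda>y. g (x, y) + \<sigma> / 2 * (norm y)\<^sup>2)"
    and "\<rho> > 0" and "\<rho> * \<sigma> < 1" and "\<delta> > 0"
    and "\<And>t. t \<in> {-M..M} \<Longrightarrow> \<omega> t \<ge> 0"
    and "\<And>t. t \<in> {-M..M} \<Longrightarrow> (\<omega> has_real_derivative \<omega>' t) (at t within {-M..M})"
    and "\<And>t. t \<in> {-M..M} \<Longrightarrow> \<omega>' t > 0"
    and "\<And>i. continuous_on Y (l i)"
    and "\<And>x y. x \<in> X \<Longrightarrow> y \<in> Y \<Longrightarrow>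
           g (x, y) = 1 / real CARD('n) * (\<Sum>i\<in>UNIV. \<omega> (x $ i) * l i y)"
    and "\<delta> > \<omega> (-M) * max_oscillation l Y"
  shows "ENNAMCQ (value_constraint g \<rho> \<delta> Y) (X \<times> Y)"
proof -
  note X = assms(2) and Y = assms(3-5) and W = assms(6,7) and \<rho> = assms(13,14)
  have False if wC: "w \<in> X \<times> Y" and R: "value_constraint g \<rho> \<delta> Y w \<ge> 0"
    and v: "v \<in> normal_cone (X \<times> Y) w" and 0: "grad (value_constraint g \<rho> \<delta> Y) w + v = 0" for w v
  proof -
    obtain x y where w: "w = (x, y)" "x \<in> X" "y \<in> Y" using wC by blast
    have xM: "x $ i \<in> {-M..M}" for i using w(2) X by simp
    have contg: "continuous_on W g"
      using assms(8) unfolding gderiv_def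
      by (meson has_derivative_at_withinI has_derivative_continuous_on)
    have "continuous_on Y (\<lambda>z. g (x, z) + 1 / (2 * \<rho>) * (norm (z - y))\<^sup>2)"
      by (intro continuous_intros continuous_on_compose2[OF contg]) (use W w in auto)
    then obtain z where z: "z \<in> Y"
      and zmin: "\<And>u. u \<in> Y \<Longrightarrow>
        g (x, z) + 1 / (2 * \<rho>) * (norm (z - y))\<^sup>2 \<le> g (x, u) + 1 / (2 * \<rho>) * (norm (u - y))\<^sup>2"
      and env: "(INF u\<in>Y. g (x, u) + 1 / (2 * \<rho>) * (norm (u - y))\<^sup>2)
        = g (x, z) + 1 / (2 * \<rho>) * (norm (z - y))\<^sup>2"
      using INF_compact_attained[OF Y(2,1)] by blast
    have dg: "GDERIV g (x, u) :> grad g (x, u)" if "u \<in> Y" for u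
      using assms(8) W w that by auto
    \<comment> \<open>\<open>prox_unique\<close> turns the minimality of \<open>z\<close> into the
      strict minimality required here.\<close>
    have "GDERIV (partial_moreau_env g \<rho> Y) (x, y) :> (fst (grad g (x, z)), (1 / \<rho>) *\<^sub>R (y - z))"
      by (rule GDERIV_partial_moreau_env[OF Y(2) W(1) _ _ assms(8) assms(9) z
            prox_unique[OF assms(12)[OF w(2)] \<rho> z _ _ zmin]]) (use W w \<rho> in auto)
    from GDERIV_diff[OF GDERIV_diff[OF dg[OF w(3)] this] GDERIV_const[of \<delta>]]
    have "GDERIV (value_constraint g \<rho> \<delta> Y) (x, y) :>
        grad g (x, y) - (fst (grad g (x, z)), (1 / \<rho>) *\<^sub>R (y - z))"
      by (simp add: value_constraint_def[abs_def])
    then have "fst (grad (value_constraint g \<rho> \<delta> Y) w) = fst (grad g (x, y)) - fst (grad g (x, z))"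
      by (simp add: grad_eqI w(1))
    then have fv: "fst v = fst (grad g (x, z)) - fst (grad g (x, y))"
      using 0 by (metis add_eq_0_iff fst_uminus minus_diff_eq)
    have comp: "fst (grad g (x, u)) $ i = 1 / real CARD('n) * (\<omega>' (x $ i) * l i u)" if "u \<in> Y" for u i
      by (rule separable_grad_component[OF _ xM dg[OF that] assms(17)[OF xM]])
        (use assms(1,20) X that in auto)
    have neg: "l i y \<le> l i z" if i: "x $ i \<noteq> -M" for i
    proof -
      \<comment> \<open>Coordinate \<open>i\<close> is moved to the face at \<open>-M\<close>, which
        stays in the box. Testing \<open>v\<close> against this displacement gives the sign of its
        component \<open>i\<close>.\<close>
      define u where "u = x + (- M - x $ i) *\<^sub>R axis i 1"
      have "u \<in> X" using xM assms(1) unfolding X u_def by (auto simp: axis_def)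
      then have "v \<bullet> ((u, y) - (x, y)) \<le> 0"
        using v w unfolding normal_cone_def by blast
      then have "fst v $ i * (- M - x $ i) \<le> 0"
        by (simp add: u_def inner_prod_def inner_axis mult.commute)
      moreover have "- M - x $ i < 0" using i xM[of i] by auto
      ultimately have "0 \<le> fst v $ i" by (simp add: mult_le_0_iff)
      then have "0 \<le> 1 / real CARD('n) * (\<omega>' (x $ i) * (l i z - l i y))"
        using comp[OF z, of i] comp[OF w(3), of i] by (simp add: fv algebra_simps diff_divide_distrib)
      then show ?thesis using assms(18)[OF xM[of i]]
        by (simp add: zero_le_divide_iff zero_le_mult_iff)
    qed
    let ?B = "\<omega> (-M) * max_oscillation l Y"
    have \<omega>0: "\<omega> (-M) \<ge> 0" using assms(1,16) by simp
    have bound: "\<omega> (x $ i) * (l i y - l i z) \<le> ?B" for i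
    proof (cases "x $ i = -M")
      case True
      then show ?thesis
        using oscillation_le_max[of Y l, OF Y(2) assms(19) w(3) z] \<omega>0 by (simp add: mult_left_mono)
    next
      case False
      have "\<omega> (x $ i) * (l i y - l i z) \<le> 0"
        using neg[OF False] assms(16)[OF xM[of i]] by (simp add: mult_nonneg_nonpos)
      \<comment> \<open>The oscillation bound with both points equal to \<open>z\<close> shows that
        the maximal oscillation is nonnegative.\<close>
      also have "0 \<le> ?B"
        using oscillation_le_max[of Y l, OF Y(2) assms(19) z z] \<omega>0 by simp
      finally show ?thesis .
    qed
    have "g (x, y) - g (x, z) = 1 / real CARD('n) * (\<Sum>i\<in>UNIV. \<omega> (x $ i) * (l i y - l i z))"
      by (simp add: assms(20)[OF w(2)] w(3) z right_diff_distrib sum_subtractf diff_divide_distrib)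
    also have "\<dots> \<le> 1 / real CARD('n) * (\<Sum>i\<in>(UNIV::'n set). ?B)"
      by (intro mult_left_mono sum_mono bound) simp
    also have "\<dots> = ?B" by simp
    finally have "g (x, y) - g (x, z) < \<delta>" using assms(21) by linarith
    \<comment> \<open>By \<open>env\<close>, the envelope at \<open>w\<close> is
      \<open>g (x, z)\<close> plus this nonnegative term, so the constraint value is at most
      \<open>g (x, y) - g (x, z) - \<delta>\<close>, which is negative.\<close>
    moreover have "0 \<le> 1 / (2 * \<rho>) * (norm (z - y))\<^sup>2" using \<rho> by simp
    ultimately show False
      using R env by (simp add: w(1) value_constraint_def partial_moreau_env_def)
  qed
  then show ?thesis unfolding ENNAMCQ_def by fastforce
qed

end
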